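(* Let $R=(R,\oplus,\odot,0_R,1_R)$ be a ring and let $t$ and $u$ be ring terms over $R$. Then $t$ and $u$ are s-equivalent if and only if they are f-equivalent: $$t\stackrel{s}{\approx}u\iff t\stackrel{f}{\approx}u.$$
   Context: Rings are commutative with identity, and $0_R\neq 1_R$. $\mathbb{N}=\{1,2,\dots\}$, $\mathbb{N}_0=\{0,1,2,\dots\}$. Ring terms. Let $V=\{x_1,x_2,\dots\}$ be a countable set of distinct variables and let $F_R=\{+,\cdot,0,1\}\cup\{c_r: r\in R\}$ be a set of distinct formal symbols ($0,1,c_r$ are constants; $0$ and $c_{0_R}$ are different symbols, and so are $1$ and $c_{1_R}$). (Ring) terms over $R$ are the words over $V\cup F_R\cup\{(\,,\,)\}$ obtained by finitely many applications of the rules: each constant $0$, $1$, $c_r$ ($r\in R$) and each variable is a term; if $t,u$ are terms then $(t+u)$ and $(t\cdot u)$ are terms. $T$ is the set of all terms. A subterm of $t$ is a term occurring as a contiguous subword of $t$; replacing a subterm means replacing one occurrence of it. Standard polynomials. $\mathbb{N}_0^{\infty}$ is the set of finite sequences over $\mathbb{N}_0$ that are empty or have nonzero last entry; the sum of two such sequences is computed entrywise after padding the shorter one with zeros. $R[x_1,x_2,\dots]$ is the set of all maps $p\colon X\to R\setminus\{0_R\}$ (viewed as sets of pairs) with finite $X\subset\mathbb{N}_0^{\infty}$. Extending $p,q$ by $0_R$ outside their domains, $p\oplus_s q$ and $p\odot_s q$ are the restrictions to the sets of nonzero values of, respectively, $\overline{m}\mapsto p(\overline{m})\oplus q(\overline{m})$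 and $\overline{m}\mapsto\bigoplus_{\overline{k}+\overline{l}=\overline{m}}p(\overline{k})\odot q(\overline{l})$. The map $\Psi\colon T\to R[x_1,x_2,\dots]$ evaluates terms: $\Psi[0]=\Psi[c_{0_R}]=\emptyset$, $\Psi[1]=\{(\emptyset,1_R)\}$, $\Psi[c_r]=\{(\emptyset,r)\}$ for $r\ne0_R$, $\Psi[x_i]=\{((0,\dots,0,1),1_R)\}$ (with an $i$-tuple), $\Psi[(t+u)]=\Psi[t]\oplus_s\Psi[u]$, $\Psi[(t\cdot u)]=\Psi[t]\odot_s\Psi[u]$. s-equivalence: $t\stackrel{s}{\approx}u$ iff $\Psi[t]=\Psi[u]$. f-equivalence: write $t\sim t'$ (and $t'\sim t$; the relation is symmetric) if $t'$ arises from $t$ by replacing a subterm $v$ with $v'$ according to one of the following rules, for some $r,s\in R$ and terms $u,u',u''$. ET$-1$: $v=0$, $v'=c_{0_R}$. ET0: $v=1$, $v'=c_{1_R}$. ET1: $v=(c_r+c_s)$, $v'=c_{r\oplus s}$. ET2: $v=(c_r\cdot c_s)$, $v'=c_{r\odot s}$. ET3: $v=(0+u)$, $v'=u$. ET4: $v=(1\cdot u)$, $v'=u$. ET5: $v=(u+u')$, $v'=(u'+u)$. ET6: $v=(u\cdot u')$, $v'=(u'\cdot u)$. ET7: $v=(u+(u'+u''))$, $v'=((u+u')+u'')$. ET8: $v=(u\cdot(u'\cdot u''))$, $v'=((u\cdot u')\cdot u'')$. ET9: $v=(u\cdot(u'+u''))$, $v'=((u\cdot u')+(u\cdot u''))$.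 ET10: $v=(0\cdot u)$, $v'=0$. Then $t\stackrel{f}{\approx}u$ iff there are $k\in\mathbb{N}$ and terms $t_0,\dots,t_k$ with $t=t_0\sim t_1\sim\dots\sim t_k=u$. *)

theory Defs
  imports "HOL-Library.Poly_Mapping"
begin

text \<open>Ring terms over a ring whose carrier is the type \<open>'r\<close>. \<open>Var i\<close> stands for
  \<open>x\<^sub>i\<^sub>+\<^sub>1\<close>: the variables are numbered from 0 here.  \<open>Zero\<close>, \<open>One\<close> are distinct from \<open>Const 0\<close>, \<open>Const 1\<close>.\<close>

datatype 'r rterm =
    Zero | One | Const 'r | Var nat
  | Add "'r rterm" "'r rterm" | Mul "'r rterm" "'r rterm"

text \<open>The alphabet, and the word that a term is. Each word in the inductive set
  \<open>term_words\<close> is the word of exactly one element of the datatype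
  (lemma \<open>bij_betw_word\<close>), so the datatype may be used for the set of terms.\<close>

datatype 'r symb =
    SZero | SOne | SConst 'r | SVar nat | SPlus | STimes | LParen | RParen

inductive_set term_words :: "'r symb list set" where
  "[SZero] \<in> term_words"
| "[SOne] \<in> term_words"
| "[SConst r] \<in> term_words"
| "[SVar i] \<in> term_words"
| "t \<in> term_words \<Longrightarrow> u \<in> term_words \<Longrightarrow> [LParen] @ t @ [SPlus] @ u @ [RParen] \<in> term_words"
| "t \<in> term_words \<Longrightarrow> u \<in> term_words \<Longrightarrow> [LParen] @ t @ [STimes] @ u @ [RParen] \<in> term_words"

primrec word :: "'r rterm \<Rightarrow> 'r symb list" where
  "word Zero = [SZero]"
| "word One = [SOne]"
| "word (Const r) = [SConst r]"
| "word (Var i) = [SVar i]"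
| "word (Add t u) = [LParen] @ word t @ [SPlus] @ word u @ [RParen]"
| "word (Mul t u) = [LParen] @ word t @ [STimes] @ word u @ [RParen]"

lemma word_append_inject: "word t @ x = word u @ y \<Longrightarrow> t = u \<and> x = y"
proof (induction t arbitrary: u x y)
  case (Add t1 t2)
  show ?case
  proof (cases u)
    case (Add u1 u2)
    with Add.prems have "word t1 @ (SPlus # word t2 @ RParen # x)
        = word u1 @ (SPlus # word u2 @ RParen # y)" by simp
    with Add.IH(1) have 1: "t1 = u1" "word t2 @ RParen # x = word u2 @ RParen # y" by blast+
    with Add.IH(2) have "t2 = u2 \<and> RParen # x = RParen # y" by blast
    with 1 Add show ?thesis by simp
  next
    case (Mul u1 u2)
    with Add.prems have "word t1 @ (SPlus # word t2 @ RParen # x)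
        = word u1 @ (STimes # word u2 @ RParen # y)" by simp
    with Add.IH(1) show ?thesis by blast
  qed (use Add.prems in auto)
next
  case (Mul t1 t2)
  show ?case
  proof (cases u)
    case (Mul u1 u2)
    with Mul.prems have "word t1 @ (STimes # word t2 @ RParen # x)
        = word u1 @ (STimes # word u2 @ RParen # y)" by simp
    with Mul.IH(1) have 1: "t1 = u1" "word t2 @ RParen # x = word u2 @ RParen # y" by blast+
    with Mul.IH(2) have "t2 = u2 \<and> RParen # x = RParen # y" by blast
    with 1 Mul show ?thesis by simp
  next
    case (Add u1 u2)
    with Mul.prems have "word t1 @ (STimes # word t2 @ RParen # x)
        = word u1 @ (SPlus # word u2 @ RParen # y)" by simp
    with Mul.IH(1) show ?thesis by blast
  qed (use Mul.prems in auto)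
qed (case_tac u; simp)+

lemma bij_betw_word: "bij_betw word UNIV term_words"
proof -
  have "inj word"
    using word_append_inject[of _ "[]" _ "[]"] by (auto intro: injI)
  moreover have "word t \<in> term_words" for t :: "'r rterm"
    by (induction t) (simp_all only: word.simps term_words.intros)
  moreover have "w \<in> range word" if "w \<in> term_words" for w :: "'r symb list"
    using that by induction (auto simp only: image_iff UNIV_I bex_UNIV word.simps[symmetric])
  ultimately show ?thesis
    by (auto simp: bij_betw_def)
qed

text \<open>The polynomial ring \<open>R[x\<^sub>1,x\<^sub>2,\<dots>]\<close>: finitely supported maps from exponent
  sequences (finitely supported maps \<open>nat \<Rightarrow>\<^sub>0 nat\<close>, added pointwise) to the ring, with
  pointwise addition and the convolution product.\<close>

type_synonym 'r std_poly = "(nat \<Rightarrow>\<^sub>0 nat) \<Rightarrow>\<^sub>0 'r"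

primrec Psi :: "'r::comm_ring_1 rterm \<Rightarrow> 'r std_poly" where
  "Psi Zero = 0"
| "Psi One = Poly_Mapping.single 0 1"
| "Psi (Const r) = Poly_Mapping.single 0 r"
| "Psi (Var i) = Poly_Mapping.single (Poly_Mapping.single i 1) 1"
| "Psi (Add t u) = Psi t + Psi u"
| "Psi (Mul t u) = Psi t * Psi u"

definition s_equiv :: "'r::comm_ring_1 rterm \<Rightarrow> 'r rterm \<Rightarrow> bool"  (infix "\<approx>\<^sub>s" 50) where
  "t \<approx>\<^sub>s u \<longleftrightarrow> Psi t = Psi u"

inductive et_rule :: "'r::comm_ring_1 rterm \<Rightarrow> 'r rterm \<Rightarrow> bool" where
  ETm1: "et_rule Zero (Const 0)"
| ET0: "et_rule One (Const 1)"
| ET1: "et_rule (Add (Const r) (Const s)) (Const (r + s))"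
| ET2: "et_rule (Mul (Const r) (Const s)) (Const (r * s))"
| ET3: "et_rule (Add Zero u) u"
| ET4: "et_rule (Mul One u) u"
| ET5: "et_rule (Add u u') (Add u' u)"
| ET6: "et_rule (Mul u u') (Mul u' u)"
| ET7: "et_rule (Add u (Add u' u'')) (Add (Add u u') u'')"
| ET8: "et_rule (Mul u (Mul u' u'')) (Mul (Mul u u') u'')"
| ET9: "et_rule (Mul u (Add u' u'')) (Add (Mul u u') (Mul u u''))"
| ET10: "et_rule (Mul Zero u) Zero"

text \<open>A subterm is a term occurring as a contiguous subword, and one occurrence is replaced.\<close>

definition et_step :: "'r::comm_ring_1 rterm \<Rightarrow> 'r rterm \<Rightarrow> bool" where
  "et_step t t' \<longleftrightarrow> (\<exists>a v v' b. et_rule v v' \<and>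
     word t = a @ word v @ b \<and> word t' = a @ word v' @ b)"

definition et_sim :: "'r::comm_ring_1 rterm \<Rightarrow> 'r rterm \<Rightarrow> bool" where
  "et_sim t t' \<longleftrightarrow> et_step t t' \<or> et_step t' t"

definition f_equiv :: "'r::comm_ring_1 rterm \<Rightarrow> 'r rterm \<Rightarrow> bool"  (infix "\<approx>\<^sub>f" 50) where
  "t \<approx>\<^sub>f u \<longleftrightarrow> (\<exists>(k::nat) ts. k \<ge> 1 \<and> ts 0 = t \<and> ts k = u \<and> (\<forall>i<k. et_sim (ts i) (ts (Suc i))))"

end

theory Submission
  imports Defs
begin

text \<open>Soundness: a stack machine computes \<open>Psi t\<close> from the word of \<open>t\<close>, and after reading the
  word of any subterm its state depends on that subterm only through \<open>Psi\<close>. Completeness: the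
  classes of terms modulo f-equivalence form a commutative semiring generated by the constants and
  the variables. Evaluating polynomials in it at the classes of the variables is a homomorphism
  that sends \<open>Psi t\<close> to the class of \<open>t\<close>, so \<open>Psi t\<close> determines that class.\<close>

section \<open>Soundness\<close>

datatype 'a token = Val 'a | OpPlus | OpTimes

text \<open>A rule rewrites a contiguous occurrence in a word, not a position in a tree, so
  \<open>Psi\<close> is recomputed by reading symbols from left to right. The last clause skips
  \<open>LParen\<close>, and also a closing bracket with no two operands to combine, so every word
  can be read.\<close>

fun machine_step :: "'r::comm_ring_1 symb \<Rightarrow> 'r std_poly token list \<Rightarrow> 'r std_poly token list" where
  "machine_step SZero st = Val (Psi Zero) # st"
| "machine_step SOne st = Val (Psi One) # st"
| "machine_step (SConst r) st = Val (Psi (Const r)) # st"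
| "machine_step (SVar i) st = Val (Psi (Var i)) # st"
| "machine_step SPlus st = OpPlus # st"
| "machine_step STimes st = OpTimes # st"
| "machine_step RParen (Val q # OpPlus # Val p # st) = Val (p + q) # st"
| "machine_step RParen (Val q # OpTimes # Val p # st) = Val (p * q) # st"
| "machine_step _ st = st"

lemma fold_machine_step_word: "fold machine_step (word t) st = Val (Psi t) # st"
  by (induction t arbitrary: st) simp_all

text \<open>Whatever stack \<open>a\<close> leaves, \<open>v\<close> and \<open>v'\<close> push the
  same value on it, and \<open>b\<close> then starts from the same state. Nothing need be known
  about how \<open>a\<close> and \<open>b\<close> parse.\<close>

lemma Psi_replace_subword:
  assumes "word t = a @ word v @ b" "word t' = a @ word v' @ b" "Psi v = Psi v'"
  shows "Psi t = Psi t'"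
proof -
  have "fold machine_step (word t) [] = fold machine_step (word t') []"
    by (simp add: assms fold_machine_step_word)
  then show ?thesis
    by (simp add: fold_machine_step_word)
qed

lemma et_rule_Psi: "et_rule v v' \<Longrightarrow> Psi v = Psi v'"
  by (induction rule: et_rule.induct)
    (simp_all add: single_add mult_single algebra_simps)

lemma et_sim_Psi: "et_sim t t' \<Longrightarrow> Psi t = Psi t'"
  unfolding et_sim_def et_step_def by (metis Psi_replace_subword et_rule_Psi)

section \<open>f-equivalence as a congruence\<close>

lemma et_sim_sym: "et_sim t u \<Longrightarrow> et_sim u t"
  by (auto simp: et_sim_def)

lemma et_rule_imp_et_sim: "et_rule v v' \<Longrightarrow> et_sim v v'"
  unfolding et_sim_def et_step_def by (metis append_Nil append_Nil2)

lemma f_equiv_iff_rtranclp: "t \<approx>\<^sub>f u \<longleftrightarrow> et_sim\<^sup>*\<^sup>* t u"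
proof
  assume "t \<approx>\<^sub>f u"
  then show "et_sim\<^sup>*\<^sup>* t u"
    unfolding f_equiv_def by (metis relpowp_fun_conv relpowp_imp_rtranclp)
next
  assume "et_sim\<^sup>*\<^sup>* t u"
  \<comment> \<open>The detour through \<open>Add Zero t\<close> makes the chain nonempty, as \<open>k \<ge> 1\<close> demands.\<close>
  moreover have "(et_sim ^^ 2) t t"
    using et_rule_imp_et_sim[OF ET3, of t] by (auto simp: numeral_2_eq_2 intro: et_sim_sym)
  ultimately obtain n where "(et_sim ^^ (2 + n)) t u"
    unfolding relpowp_add by (metis relcomppI rtranclp_imp_relpowp)
  then obtain ts where "ts 0 = t" "ts (2 + n) = u" "\<forall>i<2 + n. et_sim (ts i) (ts (Suc i))"
    unfolding relpowp_fun_conv by blast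
  then show "t \<approx>\<^sub>f u"
    unfolding f_equiv_def by (intro exI[of _ "2 + n"] exI[of _ ts]) simp
qed

lemma f_equiv_refl: "t \<approx>\<^sub>f t"
  by (simp add: f_equiv_iff_rtranclp)

lemma f_equiv_trans: "t \<approx>\<^sub>f u \<Longrightarrow> u \<approx>\<^sub>f v \<Longrightarrow> t \<approx>\<^sub>f v"
  by (simp add: f_equiv_iff_rtranclp)

lemma f_equiv_sym: "t \<approx>\<^sub>f u \<Longrightarrow> u \<approx>\<^sub>f t"
  unfolding f_equiv_iff_rtranclp
  by (metis et_sim_sym sympI sympD symp_rtranclp)

lemma f_equiv_rule: "et_rule t u \<Longrightarrow> t \<approx>\<^sub>f u"
  by (simp add: f_equiv_iff_rtranclp et_rule_imp_et_sim r_into_rtranclp)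

lemma f_equiv_imp_s_equiv: "t \<approx>\<^sub>f u \<Longrightarrow> t \<approx>\<^sub>s u"
  unfolding f_equiv_iff_rtranclp s_equiv_def
  by (induction rule: rtranclp_induct) (auto dest: et_sim_Psi)

text \<open>Since \<open>et_step\<close> allows arbitrary surrounding words, a context is described
  by the words around its hole. Lengthening the prefix by \<open>a\<close> and the suffix by
  \<open>b\<close> carries each link of the chain into the context.\<close>

lemma f_equiv_context:
  assumes "t \<approx>\<^sub>f u" and "\<And>v. word (C v) = a @ word v @ b"
  shows "C t \<approx>\<^sub>f C u"
proof -
  have "et_step (C v) (C v')" if "et_step v v'" for v v'
    using that unfolding et_step_def assms(2) by (metis append.assoc)
  then have "et_sim (C v) (C v')" if "et_sim v v'" for v v'
    using that by (auto simp: et_sim_def)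
  with assms(1) show ?thesis
    unfolding f_equiv_iff_rtranclp
    by (induction rule: rtranclp_induct) (auto intro: rtranclp.rtrancl_into_rtrancl)
qed

lemma f_equiv_Add:
  assumes "t \<approx>\<^sub>f t'" "u \<approx>\<^sub>f u'"
  shows "Add t u \<approx>\<^sub>f Add t' u'"
proof (rule f_equiv_trans)
  show "Add t u \<approx>\<^sub>f Add t' u"
    by (rule f_equiv_context[OF assms(1), of "\<lambda>v. Add v u" "[LParen]"]) simp
  show "Add t' u \<approx>\<^sub>f Add t' u'"
    by (rule f_equiv_context[OF assms(2), of "Add t'" "LParen # word t' @ [SPlus]"]) simp
qed

lemma f_equiv_Mul:
  assumes "t \<approx>\<^sub>f t'" "u \<approx>\<^sub>f u'"
  shows "Mul t u \<approx>\<^sub>f Mul t' u'"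
proof (rule f_equiv_trans)
  show "Mul t u \<approx>\<^sub>f Mul t' u"
    by (rule f_equiv_context[OF assms(1), of "\<lambda>v. Mul v u" "[LParen]"]) simp
  show "Mul t' u \<approx>\<^sub>f Mul t' u'"
    by (rule f_equiv_context[OF assms(2), of "Mul t'" "LParen # word t' @ [STimes]"]) simp
qed

section \<open>The semiring of terms modulo f-equivalence\<close>

quotient_type (overloaded) 'r fclass = "'r::comm_ring_1 rterm" / f_equiv
  by (intro equivpI reflpI sympI transpI) (blast intro: f_equiv_refl f_equiv_sym f_equiv_trans)+

instantiation fclass :: (comm_ring_1) comm_semiring_1
begin

lift_definition zero_fclass :: "'a fclass" is Zero .
lift_definition one_fclass :: "'a fclass" is One .
lift_definition plus_fclass :: "'a fclass \<Rightarrow> 'a fclass \<Rightarrow> 'a fclass" is Add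
  by (rule f_equiv_Add)
lift_definition times_fclass :: "'a fclass \<Rightarrow> 'a fclass \<Rightarrow> 'a fclass" is Mul
  by (rule f_equiv_Mul)

instance
proof
  fix a b c :: "'a fclass"
  show "a + b + c = a + (b + c)" by transfer (rule f_equiv_sym[OF f_equiv_rule[OF ET7]])
  show "a + b = b + a" by transfer (rule f_equiv_rule[OF ET5])
  show "0 + a = a" by transfer (rule f_equiv_rule[OF ET3])
  show "a * b * c = a * (b * c)" by transfer (rule f_equiv_sym[OF f_equiv_rule[OF ET8]])
  show comm: "a * b = b * a" for a b :: "'a fclass" by transfer (rule f_equiv_rule[OF ET6])
  show "1 * a = a" by transfer (rule f_equiv_rule[OF ET4])
  have distrib: "a * (b + c) = a * b + a * c" for a b c :: "'a fclass"
    by transfer (rule f_equiv_rule[OF ET9])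
  show "(a + b) * c = a * c + b * c" using distrib[of c a b] by (simp add: comm)
  show zero: "0 * a = 0" for a :: "'a fclass" by transfer (rule f_equiv_rule[OF ET10])
  show "a * 0 = 0" using zero[of a] by (simp add: comm)
  \<comment> \<open>Here soundness is used: the polynomials 0 and 1 differ, so the two classes do
    too.\<close>
  show "(0::'a fclass) \<noteq> 1"
  proof transfer
    show "\<not> Zero \<approx>\<^sub>f (One :: 'a rterm)"
      using f_equiv_imp_s_equiv[of Zero "One :: 'a rterm"] by (auto simp: s_equiv_def)
  qed
qed

end

lift_definition const_class :: "'r::comm_ring_1 \<Rightarrow> 'r fclass" is Const .
lift_definition var_class :: "nat \<Rightarrow> 'r::comm_ring_1 fclass" is Var .

text \<open>The four rules on constants make \<open>const_class\<close> a semiring homomorphism, as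
  \<open>semiring_hom\<close> demands.\<close>

lemma const_class_0: "const_class 0 = 0"
  by transfer (rule f_equiv_sym[OF f_equiv_rule[OF ETm1]])

lemma const_class_1: "const_class 1 = 1"
  by transfer (rule f_equiv_sym[OF f_equiv_rule[OF ET0]])

lemma const_class_add: "const_class (r + s) = const_class r + const_class s"
  by transfer (rule f_equiv_sym[OF f_equiv_rule[OF ET1]])

lemma const_class_mult: "const_class (r * s) = const_class r * const_class s"
  by transfer (rule f_equiv_sym[OF f_equiv_rule[OF ET2]])

section \<open>Evaluating polynomials\<close>

definition monom_eval :: "('i \<Rightarrow> 'q::comm_semiring_1) \<Rightarrow> ('i \<Rightarrow>\<^sub>0 nat) \<Rightarrow> 'q" where
  "monom_eval x m = (\<Prod>i\<in>Poly_Mapping.keys m. x i ^ Poly_Mapping.lookup m i)"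

text \<open>Extra indices have exponent 0 and contribute the factor 1, so monomials with different
  supports can share one index set.\<close>

lemma monom_eval_superset:
  assumes "finite A" "Poly_Mapping.keys m \<subseteq> A"
  shows "monom_eval x m = (\<Prod>i\<in>A. x i ^ Poly_Mapping.lookup m i)"
  unfolding monom_eval_def
  by (rule prod.mono_neutral_left) (use assms in \<open>auto simp: in_keys_iff\<close>)

lemma monom_eval_0: "monom_eval x 0 = 1"
  by (simp add: monom_eval_def)

lemma monom_eval_single: "monom_eval x (Poly_Mapping.single i 1) = x i"
  by (simp add: monom_eval_def)

lemma monom_eval_add: "monom_eval x (m + n) = monom_eval x m * monom_eval x n"
proof -
  have "Poly_Mapping.keys (m + n) \<subseteq> Poly_Mapping.keys m \<union> Poly_Mapping.keys n"
    by (rule Poly_Mapping.keys_add)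
  then show ?thesis
    by (simp add: monom_eval_superset[of "Poly_Mapping.keys m \<union> Poly_Mapping.keys n"]
        lookup_add power_add prod.distrib)
qed

lemma poly_mapping_induct [case_names single add]:
  assumes single: "\<And>m a. P (Poly_Mapping.single m a)"
    and add: "\<And>p q. P p \<Longrightarrow> P q \<Longrightarrow> P (p + q)"
  shows "P p"
proof (induction p rule: update_induct)
  \<comment> \<open>The zero polynomial is a \<open>single\<close> with coefficient 0, at any
    exponent.\<close>
  case const
  show ?case
    using single[of undefined 0] by simp
next
  case (update f m a)
  \<comment> \<open>The key \<open>m\<close> is fresh, so the update amounts to adding a
    monomial.\<close>
  then have "Poly_Mapping.update m a f = f + Poly_Mapping.single m a"
    by (intro poly_mapping_eqI)
      (auto simp: lookup_update lookup_add lookup_single in_keys_iff when_def)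
  with update show ?case
    by (simp add: single add)
qed

locale semiring_hom =
  fixes h :: "'a::comm_semiring_1 \<Rightarrow> 'q::comm_semiring_1"
  assumes hom_0: "h 0 = 0" and hom_1: "h 1 = 1"
    and hom_add: "h (a + b) = h a + h b" and hom_mult: "h (a * b) = h a * h b"
begin

definition poly_eval :: "('i \<Rightarrow> 'q) \<Rightarrow> (('i \<Rightarrow>\<^sub>0 nat) \<Rightarrow>\<^sub>0 'a) \<Rightarrow> 'q" where
  "poly_eval x p = (\<Sum>m\<in>Poly_Mapping.keys p. h (Poly_Mapping.lookup p m) * monom_eval x m)"

text \<open>Cancellation may shrink the support of a sum; by \<open>hom_0\<close> the surplus
  summands vanish.\<close>

lemma poly_eval_superset:
  assumes "finite A" "Poly_Mapping.keys p \<subseteq> A"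
  shows "poly_eval x p = (\<Sum>m\<in>A. h (Poly_Mapping.lookup p m) * monom_eval x m)"
  unfolding poly_eval_def
  by (rule sum.mono_neutral_left) (use assms in \<open>auto simp: in_keys_iff hom_0\<close>)

lemma poly_eval_0: "poly_eval x 0 = 0"
  by (simp add: poly_eval_def)

lemma poly_eval_single: "poly_eval x (Poly_Mapping.single m a) = h a * monom_eval x m"
  using poly_eval_superset[of "{m}" "Poly_Mapping.single m a" x] by simp

lemma poly_eval_add: "poly_eval x (p + q) = poly_eval x p + poly_eval x q"
proof -
  have "Poly_Mapping.keys (p + q) \<subseteq> Poly_Mapping.keys p \<union> Poly_Mapping.keys q"
    by (rule Poly_Mapping.keys_add)
  then show ?thesis
    by (simp add: poly_eval_superset[of "Poly_Mapping.keys p \<union> Poly_Mapping.keys q"]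
        lookup_add hom_add distrib_right sum.distrib)
qed

text \<open>Both sides are additive in \<open>p\<close> and in \<open>q\<close>, so two inductions
  reduce the convolution product to a product of two monomials.\<close>

lemma poly_eval_mult: "poly_eval x (p * q) = poly_eval x p * poly_eval x q"
proof (induction p rule: poly_mapping_induct)
  case (single m a)
  show ?case
    by (induction q rule: poly_mapping_induct)
      (simp_all add: mult_single poly_eval_single poly_eval_add monom_eval_add hom_mult
        algebra_simps)
next
  case (add p1 p2)
  then show ?case
    by (simp add: poly_eval_add distrib_right)
qed

end

interpretation const_hom: semiring_hom const_class
  by unfold_locales (rule const_class_0 const_class_1 const_class_add const_class_mult)+

lemma poly_eval_Psi: "const_hom.poly_eval var_class (Psi t) = abs_fclass t"
proof (induction t)
  case Zero
  show ?case
    by (simp add: const_hom.poly_eval_0 zero_fclass.abs_eq)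
next
  case One
  \<comment> \<open>The monomial \<open>single 0 1\<close> must not be folded into \<open>1\<close>,
    or \<open>poly_eval_single\<close> would no longer apply.\<close>
  show ?case
    by (simp add: const_hom.poly_eval_single monom_eval_0 const_class_1
        del: single_one flip: one_fclass.abs_eq)
next
  case (Const r)
  show ?case
    by (simp add: const_hom.poly_eval_single monom_eval_0 flip: const_class.abs_eq)
next
  case (Var i)
  show ?case
    using monom_eval_single[of var_class i]
    by (simp add: const_hom.poly_eval_single const_class_1 flip: var_class.abs_eq)
next
  case (Add t u)
  then show ?case
    by (simp add: const_hom.poly_eval_add plus_fclass.abs_eq)
next
  case (Mul t u)
  then show ?case
    by (simp add: const_hom.poly_eval_mult times_fclass.abs_eq)
qed

theorem theorem5p14:
  fixes t u :: "'r::comm_ring_1 rterm"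
  shows "t \<approx>\<^sub>s u \<longleftrightarrow> t \<approx>\<^sub>f u"
proof
  assume "t \<approx>\<^sub>s u"
  then have "abs_fclass t = abs_fclass u"
    by (metis poly_eval_Psi s_equiv_def)
  then show "t \<approx>\<^sub>f u"
    by (simp add: fclass.abs_eq_iff)
qed (rule f_equiv_imp_s_equiv)

end
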